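(* Let $M$ be an almost paracontact metric 3-dimensional Walker manifold for which $\xi_1=\xi_2=0$ and $\xi_3=\frac1{\sqrt f}$, $f>0$. Then we have: (i) $M$ is never paracosymplectic, quasi-para-Sasakian, $\alpha$-paracosymplectic, $\alpha$-para-Kenmotsu, almost paracosymplectic and normal; (ii) $M$ is almost $\alpha$-paracosymplectic if and only if $f_y=0$, $f_z=-ff_x\neq0$; and $M$ is never almost $\alpha$-para-Kenmotsu; (iii) $M\in\mathbb G_{12}$ if and only if $f_y=f_z=0$ and $f_x\neq0$.
   Context: A 3-dimensional Walker manifold is a 3-dimensional Lorentzian manifold $(M,g)$ admitting a parallel lightlike distribution of rank 1. An almost paracontact metric 3-dimensional Walker manifold $(M,\varphi,\xi,\eta,g)$ is such a manifold with the structure given, in local coordinates $(x,y,z)$ and with respect to $\{\partial_x,\partial_y,\partial_z\}$, by $$g=\begin{pmatrix}0&0&1\\0&1&0\\1&0&f\end{pmatrix},\quad \varphi=\begin{pmatrix}-\xi_2&\xi_1+f\xi_3&-f\xi_2\\ \xi_3&0&-\xi_1\\0&-\xi_3&\xi_2\end{pmatrix},$$ $\xi=\xi_1\partial_x+\xi_2\partial_y+\xi_3\partial_z$, $\eta=\xi_3dx+\xi_2dy+(\xi_1+f\xi_3)dz$, where $f=f(x,y,z)\in C^\infty(M)$ and $\xi_1,\xi_2,\xi_3\in C^\infty(M)$ satisfy $\xi_2^2+f\xi_3^2+2\xi_1\xi_3=1$ (columns of $\varphi$ are the images of the basis vectors). Subscripts $x,y,z$ on functions denote partial derivatives. Notation: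 $\phi(X,Y)=g(\varphi X,Y)$; $F(X,Y,Z)=g((\nabla_X\varphi)Y,Z)$, $\nabla$ the Levi-Civita connection; $d\eta(X,Y)=\frac12((\nabla_X\eta)Y-(\nabla_Y\eta)X)$; $d\phi(X,Y,Z)=F(X,Y,Z)+F(Y,Z,X)+F(Z,X,Y)$; $(\eta\wedge\phi)(X,Y,Z)=\eta(X)\phi(Y,Z)+\eta(Y)\phi(Z,X)+\eta(Z)\phi(X,Y)$. Classes: $M$ is normal if $N(X,Y)-2d\eta(X,Y)\xi=0$ with $N(X,Y)=\varphi^2[X,Y]+[\varphi X,\varphi Y]-\varphi[\varphi X,Y]-\varphi[X,\varphi Y]$; quasi-para-Sasakian if it is normal and $d\phi=0$; almost $\alpha$-paracosymplectic if $d\eta=0$ and $d\phi=2\alpha\,\eta\wedge\phi$, where $\alpha$ may be a constant or a function on $M$; almost $\alpha$-para-Kenmotsu if this holds with $\alpha=\mathrm{const}\neq0$; almost paracosymplectic if it holds with $\alpha=0$. If in addition $M$ is normal, the word "almost" is dropped ($\alpha$-paracosymplectic, $\alpha$-para-Kenmotsu, paracosymplectic). $M\in\mathbb G_{12}$ means $F(X,Y,Z)=\eta(X)\{\eta(Y)F(\xi,\xi,Z)-\eta(Z)F(\xi,\xi,Y)\}$ for all $X,Y,Z$.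
   Formalization: All claims except the α-para-Kenmotsu ones are stated for f not locally constant (df not identically 0), since they fail for constant f (e.g. f=1); "f_z≠0" and "f_x≠0" are read as not vanishing identically on M, the coordinate domain. *)

theory Defs
  imports "HOL-Analysis.Analysis"
begin

section \<open>Smooth functions and vector fields on an open set of Euclidean space\<close>

primrec Ck_on :: "nat \<Rightarrow> 'a::euclidean_space set \<Rightarrow> ('a \<Rightarrow> 'b::real_normed_vector) \<Rightarrow> bool" where
  "Ck_on 0 M h \<longleftrightarrow> continuous_on M h"
| "Ck_on (Suc k) M h \<longleftrightarrow> (\<forall>p\<in>M. h differentiable (at p)) \<and>
     (\<forall>v. Ck_on k M (\<lambda>p. frechet_derivative h (at p) v))"

text \<open>All derivatives are taken in the ambient space, so this is only meaningful for open \<^term>\<open>M\<close>.\<close>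

definition smooth_on :: "'a::euclidean_space set \<Rightarrow> ('a \<Rightarrow> 'b::real_normed_vector) \<Rightarrow> bool" where
  "smooth_on M h \<longleftrightarrow> (\<forall>k. Ck_on k M h)"

type_synonym 'n vfield = "real ^ 'n \<Rightarrow> real ^ 'n"
type_synonym 'n mfield = "real ^ 'n \<Rightarrow> real ^ 'n ^ 'n"

definition pd :: "'n::finite \<Rightarrow> (real ^ 'n \<Rightarrow> real) \<Rightarrow> real ^ 'n \<Rightarrow> real" where
  "pd i h p = frechet_derivative h (at p) (axis i 1)"

definition dir_deriv :: "('n::finite) vfield \<Rightarrow> (real ^ 'n \<Rightarrow> 'b::real_normed_vector) \<Rightarrow> real ^ 'n \<Rightarrow> 'b" where
  "dir_deriv X h p = frechet_derivative h (at p) (X p)"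

definition lie_bracket :: "('n::finite) vfield \<Rightarrow> 'n vfield \<Rightarrow> 'n vfield" where
  "lie_bracket X Y p = dir_deriv X Y p - dir_deriv Y X p"

section \<open>The Levi-Civita connection\<close>

text \<open>A metric is given by its Gram matrix in the coordinate frame.\<close>

definition metric_app :: "('n::finite) mfield \<Rightarrow> 'n vfield \<Rightarrow> 'n vfield \<Rightarrow> real ^ 'n \<Rightarrow> real" where
  "metric_app g X Y p = X p \<bullet> (g p *v Y p)"

definition christoffel :: "('n::finite) mfield \<Rightarrow> 'n \<Rightarrow> 'n \<Rightarrow> 'n \<Rightarrow> real ^ 'n \<Rightarrow> real" where
  "christoffel g k i j p =
     (1/2) * (\<Sum>l\<in>UNIV. matrix_inv (g p) $ k $ l *
       (pd i (\<lambda>q. g q $ j $ l) p + pd j (\<lambda>q. g q $ i $ l) p - pd l (\<lambda>q. g q $ i $ j) p))"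

definition levi_civita :: "('n::finite) mfield \<Rightarrow> 'n vfield \<Rightarrow> 'n vfield \<Rightarrow> 'n vfield" where
  "levi_civita g X Y p = dir_deriv X Y p +
     (\<chi> k. \<Sum>i\<in>UNIV. \<Sum>j\<in>UNIV. christoffel g k i j p * X p $ i * Y p $ j)"

lemma pd_cong_open:
  assumes "open M" "p \<in> M" and eq: "\<And>q. q \<in> M \<Longrightarrow> h q = h' q"
  shows "pd l h p = pd l h' p"
proof -
  have "(h has_derivative D) (at p) \<longleftrightarrow> (h' has_derivative D) (at p)" for D
    using has_derivative_transform_within_open[OF _ assms(1,2)] eq by metis
  then show ?thesis by (simp add: pd_def frechet_derivative_def)
qed

text \<open>Characterizing properties of \<^const>\<open>levi_civita\<close>: vanishing torsion and \<open>\<nabla>g = 0\<close>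
  (on the coordinate frame).\<close>

lemma levi_civita_torsion_free:
  fixes g :: "('n::finite) mfield"
  assumes "open M" "p \<in> M" and sym: "\<And>q i j. q \<in> M \<Longrightarrow> g q $ i $ j = g q $ j $ i"
  shows "levi_civita g X Y p - levi_civita g Y X p = lie_bracket X Y p"
proof -
  have pd_sym: "pd l (\<lambda>q. g q $ i $ j) p = pd l (\<lambda>q. g q $ j $ i) p" for l i j
    using assms(1,2) sym by (rule pd_cong_open)
  have chr: "christoffel g k i j p = christoffel g k j i p" for k i j
    unfolding christoffel_def by (subst pd_sym[of _ i j]) (simp add: add.commute)
  have "(\<Sum>i\<in>UNIV. \<Sum>j\<in>UNIV. christoffel g k i j p * X p $ i * Y p $ j)
      = (\<Sum>i\<in>UNIV. \<Sum>j\<in>UNIV. christoffel g k i j p * Y p $ i * X p $ j)" for k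
    by (subst sum.swap) (intro sum.cong refl, simp add: chr[of k] mult_ac)
  then show ?thesis
    by (simp add: levi_civita_def lie_bracket_def)
qed

lemma levi_civita_metric:
  fixes g :: "('n::finite) mfield"
  assumes "open M" "p \<in> M" and sym: "\<And>q i j. q \<in> M \<Longrightarrow> g q $ i $ j = g q $ j $ i"
    and inv: "invertible (g p)"
  shows "pd k (\<lambda>q. g q $ i $ j) p =
    (\<Sum>l\<in>UNIV. christoffel g l k i p * g p $ l $ j) + (\<Sum>l\<in>UNIV. christoffel g l k j p * g p $ i $ l)"
proof -
  have pd_sym: "pd l (\<lambda>q. g q $ i $ j) p = pd l (\<lambda>q. g q $ j $ i) p" for l i j
    using assms(1,2) sym by (rule pd_cong_open)
  have gi: "(\<Sum>l\<in>UNIV. g p $ j $ l * matrix_inv (g p) $ l $ m) = (if j = m then 1 else 0)" for j m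
  proof -
    have "g p ** matrix_inv (g p) = mat 1"
      using inv someI_ex[of "\<lambda>B. g p ** B = mat 1 \<and> B ** g p = mat 1"]
      by (auto simp: invertible_def matrix_inv_def)
    then show ?thesis by (simp add: matrix_matrix_mult_def mat_def vec_eq_iff)
  qed
  have low: "(\<Sum>l\<in>UNIV. christoffel g l a b p * g p $ c $ l)
    = (pd a (\<lambda>q. g q $ b $ c) p + pd b (\<lambda>q. g q $ a $ c) p - pd c (\<lambda>q. g q $ a $ b) p) / 2" for a b c
  proof -
    let ?T = "\<lambda>m. pd a (\<lambda>q. g q $ b $ m) p + pd b (\<lambda>q. g q $ a $ m) p - pd m (\<lambda>q. g q $ a $ b) p"
    have "(\<Sum>l\<in>UNIV. christoffel g l a b p * g p $ c $ l)
      = (\<Sum>l\<in>UNIV. \<Sum>m\<in>UNIV. (g p $ c $ l * matrix_inv (g p) $ l $ m) * (?T m / 2))"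
      by (intro sum.cong refl) (simp add: christoffel_def sum_distrib_left sum_distrib_right mult_ac)
    also have "\<dots> = (\<Sum>m\<in>UNIV. (\<Sum>l\<in>UNIV. g p $ c $ l * matrix_inv (g p) $ l $ m) * (?T m / 2))"
      by (subst sum.swap) (simp only: sum_distrib_right)
    also have "\<dots> = (\<Sum>m\<in>UNIV. if c = m then ?T m / 2 else 0)"
      by (intro sum.cong refl) (simp add: gi)
    also have "\<dots> = ?T c / 2" by simp
    finally show ?thesis .
  qed
  have "(\<Sum>l\<in>UNIV. christoffel g l k i p * g p $ l $ j) = (\<Sum>l\<in>UNIV. christoffel g l k i p * g p $ j $ l)"
    using sym[OF assms(2)] by (intro sum.cong refl) (metis)
  then show ?thesis
    using pd_sym[of k i j] pd_sym[of i k j] pd_sym[of j k i] by (simp add: low field_simps)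
qed

section \<open>Almost paracontact metric structures and their classes\<close>

text \<open>The tensors are given by their components in the coordinate frame; column \<open>j\<close> of
  \<open>phi\<close> is the image of the \<open>j\<close>-th basis vector.\<close>

record 'n apcm =
  base :: "(real ^ 'n) set"
  phi :: "'n mfield"
  xi  :: "'n vfield"
  eta :: "real ^ 'n \<Rightarrow> real ^ 'n"
  met :: "'n mfield"

definition fields :: "('n::finite) apcm \<Rightarrow> 'n vfield set" where
  "fields S = {X. smooth_on (base S) X}"

definition phi_app :: "('n::finite) apcm \<Rightarrow> 'n vfield \<Rightarrow> 'n vfield" where
  "phi_app S X p = phi S p *v X p"

definition eta_app :: "('n::finite) apcm \<Rightarrow> 'n vfield \<Rightarrow> real ^ 'n \<Rightarrow> real" where
  "eta_app S X p = eta S p \<bullet> X p"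

definition nabla :: "('n::finite) apcm \<Rightarrow> 'n vfield \<Rightarrow> 'n vfield \<Rightarrow> 'n vfield" where
  "nabla S = levi_civita (met S)"

definition nabla_phi :: "('n::finite) apcm \<Rightarrow> 'n vfield \<Rightarrow> 'n vfield \<Rightarrow> 'n vfield" where
  "nabla_phi S X Y p = nabla S X (phi_app S Y) p - phi_app S (nabla S X Y) p"

definition nabla_eta :: "('n::finite) apcm \<Rightarrow> 'n vfield \<Rightarrow> 'n vfield \<Rightarrow> real ^ 'n \<Rightarrow> real" where
  "nabla_eta S X Y p = dir_deriv X (eta_app S Y) p - eta_app S (nabla S X Y) p"

definition phi_form :: "('n::finite) apcm \<Rightarrow> 'n vfield \<Rightarrow> 'n vfield \<Rightarrow> real ^ 'n \<Rightarrow> real" where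
  "phi_form S X Y = metric_app (met S) (phi_app S X) Y"

definition F_tensor :: "('n::finite) apcm \<Rightarrow> 'n vfield \<Rightarrow> 'n vfield \<Rightarrow> 'n vfield \<Rightarrow> real ^ 'n \<Rightarrow> real" where
  "F_tensor S X Y Z = metric_app (met S) (nabla_phi S X Y) Z"

definition d_eta :: "('n::finite) apcm \<Rightarrow> 'n vfield \<Rightarrow> 'n vfield \<Rightarrow> real ^ 'n \<Rightarrow> real" where
  "d_eta S X Y p = (1/2) * (nabla_eta S X Y p - nabla_eta S Y X p)"

definition d_phi :: "('n::finite) apcm \<Rightarrow> 'n vfield \<Rightarrow> 'n vfield \<Rightarrow> 'n vfield \<Rightarrow> real ^ 'n \<Rightarrow> real" where
  "d_phi S X Y Z p = F_tensor S X Y Z p + F_tensor S Y Z X p + F_tensor S Z X Y p"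

definition eta_wedge_phi :: "('n::finite) apcm \<Rightarrow> 'n vfield \<Rightarrow> 'n vfield \<Rightarrow> 'n vfield \<Rightarrow> real ^ 'n \<Rightarrow> real" where
  "eta_wedge_phi S X Y Z p =
     eta_app S X p * phi_form S Y Z p + eta_app S Y p * phi_form S Z X p + eta_app S Z p * phi_form S X Y p"

definition nijenhuis :: "('n::finite) apcm \<Rightarrow> 'n vfield \<Rightarrow> 'n vfield \<Rightarrow> 'n vfield" where
  "nijenhuis S X Y p =
     phi_app S (phi_app S (lie_bracket X Y)) p + lie_bracket (phi_app S X) (phi_app S Y) p
     - phi_app S (lie_bracket (phi_app S X) Y) p - phi_app S (lie_bracket X (phi_app S Y)) p"

definition eta_closed :: "('n::finite) apcm \<Rightarrow> bool" where
  "eta_closed S \<longleftrightarrow> (\<forall>X\<in>fields S. \<forall>Y\<in>fields S. \<forall>p\<in>base S. d_eta S X Y p = 0)"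

definition phi_closed :: "('n::finite) apcm \<Rightarrow> bool" where
  "phi_closed S \<longleftrightarrow> (\<forall>X\<in>fields S. \<forall>Y\<in>fields S. \<forall>Z\<in>fields S. \<forall>p\<in>base S. d_phi S X Y Z p = 0)"

definition normal_apcm :: "('n::finite) apcm \<Rightarrow> bool" where
  "normal_apcm S \<longleftrightarrow> (\<forall>X\<in>fields S. \<forall>Y\<in>fields S. \<forall>p\<in>base S.
     nijenhuis S X Y p - (2 * d_eta S X Y p) *\<^sub>R xi S p = 0)"

definition quasi_para_Sasakian :: "('n::finite) apcm \<Rightarrow> bool" where
  "quasi_para_Sasakian S \<longleftrightarrow> normal_apcm S \<and> phi_closed S"

definition almost_alpha_paracosymplectic :: "(real ^ 'n \<Rightarrow> real) \<Rightarrow> ('n::finite) apcm \<Rightarrow> bool" where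
  "almost_alpha_paracosymplectic \<alpha> S \<longleftrightarrow> smooth_on (base S) \<alpha> \<and> eta_closed S \<and>
     (\<forall>X\<in>fields S. \<forall>Y\<in>fields S. \<forall>Z\<in>fields S. \<forall>p\<in>base S.
        d_phi S X Y Z p = 2 * \<alpha> p * eta_wedge_phi S X Y Z p)"

definition alpha_paracosymplectic :: "(real ^ 'n \<Rightarrow> real) \<Rightarrow> ('n::finite) apcm \<Rightarrow> bool" where
  "alpha_paracosymplectic \<alpha> S \<longleftrightarrow> almost_alpha_paracosymplectic \<alpha> S \<and> normal_apcm S"

definition almost_alpha_para_Kenmotsu :: "real \<Rightarrow> ('n::finite) apcm \<Rightarrow> bool" where
  "almost_alpha_para_Kenmotsu a S \<longleftrightarrow> a \<noteq> 0 \<and> almost_alpha_paracosymplectic (\<lambda>_. a) S"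

definition alpha_para_Kenmotsu :: "real \<Rightarrow> ('n::finite) apcm \<Rightarrow> bool" where
  "alpha_para_Kenmotsu a S \<longleftrightarrow> almost_alpha_para_Kenmotsu a S \<and> normal_apcm S"

definition almost_paracosymplectic :: "('n::finite) apcm \<Rightarrow> bool" where
  "almost_paracosymplectic S \<longleftrightarrow> almost_alpha_paracosymplectic (\<lambda>_. 0) S"

definition paracosymplectic :: "('n::finite) apcm \<Rightarrow> bool" where
  "paracosymplectic S \<longleftrightarrow> almost_paracosymplectic S \<and> normal_apcm S"

definition in_G12 :: "('n::finite) apcm \<Rightarrow> bool" where
  "in_G12 S \<longleftrightarrow> (\<forall>X\<in>fields S. \<forall>Y\<in>fields S. \<forall>Z\<in>fields S. \<forall>p\<in>base S.
     F_tensor S X Y Z p =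
       eta_app S X p * (eta_app S Y p * F_tensor S (xi S) (xi S) Z p
                        - eta_app S Z p * F_tensor S (xi S) (xi S) Y p))"

section \<open>The 3-dimensional Walker structure\<close>

text \<open>\<^term>\<open>M\<close> is the domain of the coordinates \<open>(x, y, z)\<close>, which are the components
  \<open>1, 2, 3\<close> of a point.\<close>

definition walker_data :: "(real ^ 3) set \<Rightarrow> (real ^ 3 \<Rightarrow> real) \<Rightarrow>
    (real ^ 3 \<Rightarrow> real) \<Rightarrow> (real ^ 3 \<Rightarrow> real) \<Rightarrow> (real ^ 3 \<Rightarrow> real) \<Rightarrow> bool" where
  "walker_data M f \<xi>1 \<xi>2 \<xi>3 \<longleftrightarrow> open M \<and> M \<noteq> {} \<and>
     smooth_on M f \<and> smooth_on M \<xi>1 \<and> smooth_on M \<xi>2 \<and> smooth_on M \<xi>3 \<and>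
     (\<forall>p\<in>M. (\<xi>2 p)\<^sup>2 + f p * (\<xi>3 p)\<^sup>2 + 2 * \<xi>1 p * \<xi>3 p = 1)"

definition walker_apcm :: "(real ^ 3) set \<Rightarrow> (real ^ 3 \<Rightarrow> real) \<Rightarrow>
    (real ^ 3 \<Rightarrow> real) \<Rightarrow> (real ^ 3 \<Rightarrow> real) \<Rightarrow> (real ^ 3 \<Rightarrow> real) \<Rightarrow> 3 apcm" where
  "walker_apcm M f \<xi>1 \<xi>2 \<xi>3 = \<lparr>
     base = M,
     phi = (\<lambda>p. vector [vector [- \<xi>2 p, \<xi>1 p + f p * \<xi>3 p, - f p * \<xi>2 p],
                        vector [\<xi>3 p, 0, - \<xi>1 p],
                        vector [0, - \<xi>3 p, \<xi>2 p]]),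
     xi = (\<lambda>p. vector [\<xi>1 p, \<xi>2 p, \<xi>3 p]),
     eta = (\<lambda>p. vector [\<xi>3 p, \<xi>2 p, \<xi>1 p + f p * \<xi>3 p]),
     met = (\<lambda>p. vector [vector [0, 0, 1],
                        vector [0, 1, 0],
                        vector [1, 0, f p]]) \<rparr>"

lemma walker_apcm_metric_invertible: "invertible (met (walker_apcm M f \<xi>1 \<xi>2 \<xi>3) p)"
  by (simp add: walker_apcm_def invertible_det_nz det_3)

lemma walker_apcm_structure:
  assumes "walker_data M f \<xi>1 \<xi>2 \<xi>3" "p \<in> M"
  defines "S \<equiv> walker_apcm M f \<xi>1 \<xi>2 \<xi>3"
  shows "phi_app S (phi_app S X) p = X p - eta_app S X p *\<^sub>R xi S p"
    and "eta_app S (xi S) p = 1"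
    and "metric_app (met S) (phi_app S X) (phi_app S Y) p
      = - metric_app (met S) X Y p + eta_app S X p * eta_app S Y p"
    and "eta_app S X p = metric_app (met S) X (xi S) p"
proof -
  have c: "(\<xi>2 p)\<^sup>2 + f p * (\<xi>3 p)\<^sup>2 + 2 * \<xi>1 p * \<xi>3 p = 1"
    using assms by (simp add: walker_data_def)
  note d = S_def walker_apcm_def phi_app_def eta_app_def metric_app_def vec_eq_iff forall_3
    matrix_vector_mult_def inner_vec_def sum_3
  show "phi_app S (phi_app S X) p = X p - eta_app S X p *\<^sub>R xi S p"
    using c by (simp add: d) (intro conjI; algebra)
  show "eta_app S (xi S) p = 1"
    using c by (simp add: d) algebra
  show "metric_app (met S) (phi_app S X) (phi_app S Y) p
      = - metric_app (met S) X Y p + eta_app S X p * eta_app S Y p"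
    using c by (simp add: d) algebra
  show "eta_app S X p = metric_app (met S) X (xi S) p"
    by (simp add: d algebra_simps)
qed

text \<open>The classes are closed conditions: if \<open>f\<close> is locally constant then the structure is
  parallel (\<open>F = 0\<close>) and lies in all of them except the (almost) \<open>\<alpha>\<close>-para-Kenmotsu ones.
  On a connected domain the following says that \<open>f\<close> is not constant.\<close>

definition not_locally_constant :: "(real ^ 3) set \<Rightarrow> (real ^ 3 \<Rightarrow> real) \<Rightarrow> bool" where
  "not_locally_constant M f \<longleftrightarrow> (\<exists>p\<in>M. frechet_derivative f (at p) \<noteq> (\<lambda>v. 0))"

end

theory Submission
  imports Defs
begin

text \<open>With \<open>s = \<surd>f\<close> the structure is \<open>\<phi> \<partial>\<^sub>x = s\<inverse> \<partial>\<^sub>y\<close>, \<open>\<phi> \<partial>\<^sub>y = s \<partial>\<^sub>x - s\<inverse> \<partial>\<^sub>z\<close>,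
  \<open>\<phi> \<partial>\<^sub>z = 0\<close>, \<open>\<xi> = s\<inverse> \<partial>\<^sub>z\<close>, \<open>\<eta> = s\<inverse> dx + s dz\<close>, and the fundamental form is \<open>s\<inverse> dx \<and> dy\<close>.
  So \<open>d\<eta> = 0\<close> amounts to \<open>f\<^sub>y = 0\<close>, \<open>f\<^sub>z = - f f\<^sub>x\<close>, and \<open>d\<phi> = 2 \<alpha> \<eta> \<and> \<phi>\<close> to
  \<open>f\<^sub>z = - 4 \<alpha> s\<^sup>3\<close>. Normality evaluated on \<open>(\<partial>\<^sub>x, \<partial>\<^sub>y)\<close> and \<open>(\<partial>\<^sub>x, \<partial>\<^sub>z)\<close> already forces \<open>df = 0\<close>.
  If \<open>\<alpha>\<close> is a nonzero constant \<open>a\<close>, then \<open>s\<^sub>x = 2 a\<close> and \<open>s\<^sub>z = - 2 a s\<^sup>2\<close>, which are incompatible.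
  Membership in \<open>G\<^sub>1\<^sub>2\<close> is tested on \<open>F(\<partial>\<^sub>i, \<partial>\<^sub>x, \<partial>\<^sub>y)\<close>, which must be proportional to \<open>\<eta>(\<partial>\<^sub>i)\<close>.\<close>

section \<open>Coordinates on R^3 and smooth functions on an open set\<close>

lemma vector3_eq:
  "(vector [a, b, c] :: real ^ 3) = a *\<^sub>R axis 1 1 + b *\<^sub>R axis 2 1 + c *\<^sub>R axis 3 1"
  by (simp add: vec_eq_iff forall_3 axis_def)

lemma vec3_expand: "(v :: real ^ 3) = v $ 1 *\<^sub>R axis 1 1 + v $ 2 *\<^sub>R axis 2 1 + v $ 3 *\<^sub>R axis 3 1"
  by (simp add: vec_eq_iff forall_3 axis_def)

lemma axis_one_nth: "axis i 1 $ j = (if j = i then 1 else 0 :: real)"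
  by (simp add: axis_def)

lemma frechet_derivative_pd3:
  fixes h :: "real ^ 3 \<Rightarrow> real"
  assumes "h differentiable (at p)"
  shows "frechet_derivative h (at p) v = v $ 1 * pd 1 h p + v $ 2 * pd 2 h p + v $ 3 * pd 3 h p"
proof -
  have L: "linear (frechet_derivative h (at p))"
    using assms by (rule linear_frechet_derivative)
  show ?thesis
    by (subst vec3_expand[of v]) (simp only: linear_add[OF L] linear_scale[OF L] pd_def real_scaleR_def)
qed

lemma dir_deriv_eqI: "(h has_derivative h') (at p) \<Longrightarrow> dir_deriv X h p = h' (X p)"
  by (metis dir_deriv_def frechet_derivative_at)

lemma Ck_on_const: "Ck_on k M (\<lambda>_. c)"
  by (induction k arbitrary: c) (simp_all add: frechet_derivative_const)

lemma smooth_on_const: "smooth_on M (\<lambda>_. c)"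
  by (simp add: smooth_on_def Ck_on_const)

lemma smooth_on_differentiable: "smooth_on M h \<Longrightarrow> p \<in> M \<Longrightarrow> h differentiable (at p)"
  unfolding smooth_on_def using Ck_on.simps(2) by blast

lemma smooth_on_frechet_derivative:
  "smooth_on M h \<Longrightarrow> smooth_on M (\<lambda>p. frechet_derivative h (at p) v)"
  unfolding smooth_on_def using Ck_on.simps(2) by blast

lemma smooth_on_pd: "smooth_on M h \<Longrightarrow> smooth_on M (pd i h)"
  using smooth_on_frechet_derivative[of M h "axis i 1"] unfolding pd_def[abs_def] .

text \<open>On an open set derivatives depend only on germs. Hence a derivative formula valid only
  on \<open>M\<close>, such as the product rule, may replace the actual derivative.\<close>

lemma Ck_on_cong:
  assumes "open M" "\<And>p. p \<in> M \<Longrightarrow> h p = h' p"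
  shows "Ck_on k M h \<longleftrightarrow> Ck_on k M h'"
  using assms(2)
proof (induction k arbitrary: h h')
  case 0
  then show ?case by (simp cong: continuous_on_cong)
next
  case (Suc k)
  have hd: "(h has_derivative D) (at p) \<longleftrightarrow> (h' has_derivative D) (at p)" if "p \<in> M" for p D
    using has_derivative_transform_within_open[OF _ assms(1) that] Suc.prems by metis
  \<comment> \<open>\<open>frechet_derivative\<close> is a choice over
    \<open>has_derivative\<close>; by \<open>hd\<close> both choices range over the same predicate,
    so they agree even without differentiability.\<close>
  have "Ck_on k M (\<lambda>p. frechet_derivative h (at p) v) \<longleftrightarrow> Ck_on k M (\<lambda>p. frechet_derivative h' (at p) v)" for v
    by (rule Suc.IH) (simp add: frechet_derivative_def hd)
  then show ?case by (auto simp: differentiable_def hd)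
qed

text \<open>The product rule pairs an undifferentiated factor with a derivative; this lowers the
  former to the order of the latter.\<close>

lemma Ck_on_Suc_imp: "Ck_on (Suc k) M h \<Longrightarrow> Ck_on k M h"
proof (induction k arbitrary: h)
  case 0
  then show ?case
    by (simp add: differentiable_imp_continuous_on differentiable_on_def differentiable_at_withinI)
next
  case (Suc k)
  then show ?case by (metis Ck_on.simps(2))
qed

lemma Ck_on_add:
  assumes "open M" "Ck_on k M h" "Ck_on k M h'"
  shows "Ck_on k M (\<lambda>p. h p + h' p)"
  using assms(2,3)
proof (induction k arbitrary: h h')
  case 0
  then show ?case by (auto intro: continuous_on_add)
next
  case (Suc k)
  have "Ck_on k M (\<lambda>p. frechet_derivative (\<lambda>p. h p + h' p) (at p) v)" for v
  proof (subst Ck_on_cong[OF \<open>open M\<close>])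
    show "Ck_on k M (\<lambda>p. frechet_derivative h (at p) v + frechet_derivative h' (at p) v)"
      using Suc by simp
    show "frechet_derivative (\<lambda>p. h p + h' p) (at p) v
        = frechet_derivative h (at p) v + frechet_derivative h' (at p) v" if "p \<in> M" for p
      using Suc.prems that
      by (intro fun_cong[OF frechet_derivative_at[symmetric], of _ _ _ v] has_derivative_add)
        (simp_all add: frechet_derivative_works[symmetric])
  qed
  with Suc.prems show ?case by simp
qed

lemma Ck_on_mult:
  fixes h h' :: "'a::euclidean_space \<Rightarrow> real"
  assumes "open M" "Ck_on k M h" "Ck_on k M h'"
  shows "Ck_on k M (\<lambda>p. h p * h' p)"
  using assms(2,3)
proof (induction k arbitrary: h h')
  case 0
  then show ?case by (auto intro: continuous_on_mult)
next
  case (Suc k)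
  have "Ck_on k M (\<lambda>p. frechet_derivative (\<lambda>p. h p * h' p) (at p) v)" for v
  proof (subst Ck_on_cong[OF \<open>open M\<close>])
    show "Ck_on k M (\<lambda>p. h p * frechet_derivative h' (at p) v + frechet_derivative h (at p) v * h' p)"
      using Suc.prems Suc.prems[THEN Ck_on_Suc_imp] by (intro Ck_on_add[OF \<open>open M\<close>] Suc.IH) auto
    show "frechet_derivative (\<lambda>p. h p * h' p) (at p) v
        = h p * frechet_derivative h' (at p) v + frechet_derivative h (at p) v * h' p" if "p \<in> M" for p
      using Suc.prems that
      by (intro fun_cong[OF frechet_derivative_at[symmetric], of _ _ _ v] has_derivative_mult)
        (simp_all add: frechet_derivative_works[symmetric])
  qed
  with Suc.prems show ?case by simp
qed

lemma smooth_on_mult: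
  fixes h h' :: "'a::euclidean_space \<Rightarrow> real"
  shows "open M \<Longrightarrow> smooth_on M h \<Longrightarrow> smooth_on M h' \<Longrightarrow> smooth_on M (\<lambda>p. h p * h' p)"
  by (simp add: smooth_on_def Ck_on_mult)

lemma matrix_inv_eqI:
  fixes A :: "real ^ 'n ^ 'n"
  assumes "A ** B = mat 1"
  shows "matrix_inv A = B"
proof -
  have BA: "B ** A = mat 1" using assms by (simp add: matrix_left_right_inverse)
  then have "A ** matrix_inv A = mat 1 \<and> matrix_inv A ** A = mat 1"
    unfolding matrix_inv_def using assms by (metis (mono_tags, lifting) someI_ex)
  then show ?thesis using BA by (metis matrix_mul_assoc matrix_mul_lid matrix_mul_rid)
qed

section \<open>Structure tensors when \<xi> is proportional to the third coordinate field\<close>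

locale vertical_walker =
  fixes M :: "(real ^ 3) set" and f \<xi>1 \<xi>2 \<xi>3 :: "real ^ 3 \<Rightarrow> real" and S :: "3 apcm"
  assumes data: "walker_data M f \<xi>1 \<xi>2 \<xi>3"
    and S: "S = walker_apcm M f \<xi>1 \<xi>2 \<xi>3"
    and f_pos: "\<forall>p\<in>M. f p > 0"
    and xi12: "\<forall>p\<in>M. \<xi>1 p = 0 \<and> \<xi>2 p = 0"
    and xi3: "\<forall>p\<in>M. \<xi>3 p = 1 / sqrt (f p)"
begin

text \<open>In terms of \<open>s\<close> every component is rational with positive denominators, so
  the tensor identities below become field arithmetic free of roots.\<close>

definition s :: "real ^ 3 \<Rightarrow> real" where "s p = sqrt (f p)"

lemma open_M: "open M" and smooth_f: "smooth_on M f" and smooth_xi3: "smooth_on M \<xi>3"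
  using data by (auto simp: walker_data_def)

lemma base_S [simp]: "base S = M"
  by (simp add: S walker_apcm_def)

lemma s_pos: "p \<in> M \<Longrightarrow> s p > 0"
  using f_pos by (simp add: s_def)

lemma f_eq: "p \<in> M \<Longrightarrow> f p = (s p)\<^sup>2"
  using f_pos by (simp add: s_def less_imp_le)

lemma f_over_s: "p \<in> M \<Longrightarrow> f p / s p = s p"
  using s_pos[of p] by (simp add: f_eq power2_eq_square)

definition df :: "real ^ 3 \<Rightarrow> real ^ 3 \<Rightarrow> real" where
  "df p v = v $ 1 * pd 1 f p + v $ 2 * pd 2 f p + v $ 3 * pd 3 f p"

lemma f_has_derivative: "p \<in> M \<Longrightarrow> (f has_derivative df p) (at p)"
proof -
  assume "p \<in> M"
  then have d: "f differentiable (at p)" using smooth_f by (rule smooth_on_differentiable[rotated])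
  then have "frechet_derivative f (at p) = df p"
    by (intro ext) (simp add: df_def frechet_derivative_pd3)
  with d show ?thesis using frechet_derivative_works by metis
qed

lemma s_has_derivative:
  assumes "p \<in> M" shows "(s has_derivative (\<lambda>v. df p v / (2 * s p))) (at p)"
  unfolding s_def[abs_def] using assms f_pos
  by (auto intro!: derivative_eq_intros f_has_derivative simp: field_simps)

lemma phi_S:
  assumes "p \<in> M"
  shows "phi S p *v v = vector [s p * v $ 2, v $ 1 / s p, - (v $ 2 / s p)]"
proof -
  have x: "\<xi>1 p = 0" "\<xi>2 p = 0" "\<xi>3 p = 1 / s p" using assms xi12 xi3 by (auto simp: s_def)
  show ?thesis
    using f_over_s[OF assms] by (simp add: S walker_apcm_def vec_eq_iff forall_3 matrix_vector_mult_def sum_3 x)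
qed

lemma eta_S:
  assumes "p \<in> M"
  shows "eta S p \<bullet> v = v $ 1 / s p + s p * v $ 3"
proof -
  have x: "\<xi>1 p = 0" "\<xi>2 p = 0" "\<xi>3 p = 1 / s p" using assms xi12 xi3 by (auto simp: s_def)
  show ?thesis
    using f_over_s[OF assms] by (simp add: S walker_apcm_def inner_vec_def sum_3 x)
qed

lemma xi_S: "p \<in> M \<Longrightarrow> xi S p = vector [0, 0, 1 / s p]"
  using xi12 xi3 by (simp add: S walker_apcm_def s_def)

text \<open>The G12 condition contains F(\<xi>, \<xi>, Z), and F differentiates its second
  argument.\<close>

lemma xi_S_differentiable:
  assumes "p \<in> M" shows "xi S differentiable (at p)"
proof -
  have "((\<lambda>q. vector [0, 0, 1 / s q] :: real ^ 3) has_derivative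
      (\<lambda>v. (- (df p v / (2 * s p)) / (s p)\<^sup>2) *\<^sub>R axis 3 1)) (at p)"
    unfolding vector3_eq using assms s_pos[OF assms]
    by (auto intro!: derivative_eq_intros s_has_derivative simp: power2_eq_square divide_simps)
  then have "(xi S has_derivative (\<lambda>v. (- (df p v / (2 * s p)) / (s p)\<^sup>2) *\<^sub>R axis 3 1)) (at p)"
    by (rule has_derivative_transform_within_open[OF _ open_M assms]) (simp add: xi_S)
  then show ?thesis by (auto simp: differentiable_def)
qed

section \<open>The Levi-Civita connection and covariant derivatives\<close>

lemma met_S: "met S p *v v = vector [v $ 3, v $ 2, v $ 1 + f p * v $ 3]"
  by (simp add: S walker_apcm_def vec_eq_iff forall_3 matrix_vector_mult_def sum_3)

lemma inner_met_S: "u \<bullet> (met S p *v v) = u $ 1 * v $ 3 + u $ 2 * v $ 2 + u $ 3 * (v $ 1 + f p * v $ 3)"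
  by (simp add: met_S inner_vec_def sum_3)

lemma matrix_inv_met: "matrix_inv (met S p) = vector [vector [- f p, 0, 1], vector [0, 1, 0], vector [1, 0, 0]]"
  by (rule matrix_inv_eqI)
    (simp add: S walker_apcm_def vec_eq_iff forall_3 matrix_matrix_mult_def sum_3 mat_def)

lemma pd_met: "pd i (\<lambda>q. met S q $ j $ l) p = (if j = 3 \<and> l = 3 then pd i f p else 0)"
  using exhaust_3[of j] exhaust_3[of l]
  by (auto simp: S walker_apcm_def pd_def frechet_derivative_const)

text \<open>The Christoffel term of the connection. Only the metric entry g_33 = f varies, so up to
  symmetry just Gamma^1_13, Gamma^1_23, Gamma^1_33, Gamma^2_33 and Gamma^3_33 can be
  nonzero.\<close>

definition Gamma_app :: "real ^ 3 \<Rightarrow> real ^ 3 \<Rightarrow> real ^ 3 \<Rightarrow> real ^ 3" where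
  "Gamma_app p u v = vector
     [(pd 1 f p * (u $ 1 * v $ 3 + u $ 3 * v $ 1) + pd 2 f p * (u $ 2 * v $ 3 + u $ 3 * v $ 2)
        + (f p * pd 1 f p + pd 3 f p) * u $ 3 * v $ 3) / 2,
      - (pd 2 f p * u $ 3 * v $ 3 / 2),
      - (pd 1 f p * u $ 3 * v $ 3 / 2)]"

lemma nabla_S: "nabla S X Y p = dir_deriv X Y p + Gamma_app p (X p) (Y p)"
  unfolding nabla_def levi_civita_def
  by (simp add: Gamma_app_def vec_eq_iff forall_3 sum_3 christoffel_def pd_met matrix_inv_met algebra_simps
      add_divide_distrib diff_divide_distrib)

lemma frame_has_derivative:
  assumes p: "p \<in> M" and Y: "Y differentiable (at p)"
  shows "((\<lambda>q. s q * Y q $ i) has_derivative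
      (\<lambda>v. df p v / (2 * s p) * Y p $ i + s p * frechet_derivative Y (at p) v $ i)) (at p)"
    and "((\<lambda>q. Y q $ i / s q) has_derivative
      (\<lambda>v. frechet_derivative Y (at p) v $ i / s p - df p v / (2 * s p ^ 3) * Y p $ i)) (at p)"
proof -
  have c: "((\<lambda>q. Y q $ i) has_derivative (\<lambda>v. frechet_derivative Y (at p) v $ i)) (at p)" for i
    using Y by (intro bounded_linear.has_derivative[OF bounded_linear_vec_nth])
      (simp add: frechet_derivative_works[symmetric])
  note sp = s_pos[OF p]
  show "((\<lambda>q. s q * Y q $ i) has_derivative
      (\<lambda>v. df p v / (2 * s p) * Y p $ i + s p * frechet_derivative Y (at p) v $ i)) (at p)"
    using p by (auto intro!: derivative_eq_intros c s_has_derivative)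
  show "((\<lambda>q. Y q $ i / s q) has_derivative
      (\<lambda>v. frechet_derivative Y (at p) v $ i / s p - df p v / (2 * s p ^ 3) * Y p $ i)) (at p)"
    apply (rule derivative_eq_intros c s_has_derivative[OF p] refl)+
    using sp by (simp_all add: fun_eq_iff field_simps power2_eq_square power3_eq_cube)
qed

text \<open>The derivative along u of the matrix of \<phi>, applied to v; its entries come from ds =
  df / (2 s) and d(1/s) = - df / (2 s^3).\<close>

definition phi_deriv :: "real ^ 3 \<Rightarrow> real ^ 3 \<Rightarrow> real ^ 3 \<Rightarrow> real ^ 3" where
  "phi_deriv p u v = vector [df p u / (2 * s p) * v $ 2,
      - (df p u / (2 * s p ^ 3) * v $ 1), df p u / (2 * s p ^ 3) * v $ 2]"

lemma dir_deriv_phi_app: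
  assumes p: "p \<in> M" and Y: "Y differentiable (at p)"
  shows "dir_deriv X (phi_app S Y) p = phi_deriv p (X p) (Y p) + phi S p *v dir_deriv X Y p"
proof -
  let ?D = "\<lambda>v. (df p v / (2 * s p) * Y p $ 2 + s p * frechet_derivative Y (at p) v $ 2) *\<^sub>R axis 1 1
    + (frechet_derivative Y (at p) v $ 1 / s p - df p v / (2 * s p ^ 3) * Y p $ 1) *\<^sub>R axis 2 1
    + (- (frechet_derivative Y (at p) v $ 2 / s p - df p v / (2 * s p ^ 3) * Y p $ 2)) *\<^sub>R axis 3 1 :: real ^ 3"
  have "((\<lambda>q. vector [s q * Y q $ 2, Y q $ 1 / s q, - (Y q $ 2 / s q)]) has_derivative ?D) (at p)"
    unfolding vector3_eq
    by (intro has_derivative_add has_derivative_scaleR_left has_derivative_minus frame_has_derivative p Y)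
  then have "(phi_app S Y has_derivative ?D) (at p)"
    by (rule has_derivative_transform_within_open[OF _ open_M p]) (simp add: phi_app_def phi_S)
  from dir_deriv_eqI[OF this] show ?thesis
    by (simp add: phi_S[OF p] phi_deriv_def vec_eq_iff forall_3 axis_one_nth dir_deriv_def)
qed

lemma dir_deriv_eta_app:
  assumes p: "p \<in> M" and Y: "Y differentiable (at p)"
  shows "dir_deriv X (eta_app S Y) p = df p (X p) / (2 * s p) * Y p $ 3
      - df p (X p) / (2 * s p ^ 3) * Y p $ 1 + eta S p \<bullet> dir_deriv X Y p"
proof -
  have "((\<lambda>q. Y q $ 1 / s q + s q * Y q $ 3) has_derivative
    (\<lambda>v. (frechet_derivative Y (at p) v $ 1 / s p - df p v / (2 * s p ^ 3) * Y p $ 1) +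
      (df p v / (2 * s p) * Y p $ 3 + s p * frechet_derivative Y (at p) v $ 3))) (at p)"
    by (intro has_derivative_add frame_has_derivative p Y)
  then have "(eta_app S Y has_derivative
    (\<lambda>v. (frechet_derivative Y (at p) v $ 1 / s p - df p v / (2 * s p ^ 3) * Y p $ 1) +
      (df p v / (2 * s p) * Y p $ 3 + s p * frechet_derivative Y (at p) v $ 3))) (at p)"
    by (rule has_derivative_transform_within_open[OF _ open_M p]) (simp add: eta_app_def eta_S)
  from dir_deriv_eqI[OF this] show ?thesis
    by (simp add: eta_S[OF p] dir_deriv_def)
qed

text \<open>By the Leibniz rule the ordinary derivatives of \<open>Y\<close> cancel. What remains
  depends only on values at \<open>p\<close>, so constant frame fields can serve as test
  fields.\<close>

lemma F_tensor_S:
  assumes p: "p \<in> M" and Y: "Y differentiable (at p)"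
  shows "F_tensor S X Y Z p = (phi_deriv p (X p) (Y p) + Gamma_app p (X p) (phi S p *v Y p)
    - phi S p *v Gamma_app p (X p) (Y p)) \<bullet> (met S p *v Z p)"
  by (simp add: F_tensor_def metric_app_def nabla_phi_def nabla_S dir_deriv_phi_app[OF p Y]
      phi_app_def[of S _ p] matrix_vector_right_distrib inner_add_left inner_diff_left)

text \<open>The symmetric Christoffel terms cancel, leaving the exterior derivative of dx / s + s
  dz; f_x / s is rewritten as f f_x / s^3 to share a denominator.\<close>

lemma d_eta_S:
  assumes p: "p \<in> M" and X: "X differentiable (at p)" and Y: "Y differentiable (at p)"
  shows "2 * d_eta S X Y p =
    (pd 2 f p / (2 * s p ^ 3)) * (X p $ 1 * Y p $ 2 - X p $ 2 * Y p $ 1)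
    + ((f p * pd 1 f p + pd 3 f p) / (2 * s p ^ 3)) * (X p $ 1 * Y p $ 3 - X p $ 3 * Y p $ 1)
    + (pd 2 f p / (2 * s p)) * (X p $ 2 * Y p $ 3 - X p $ 3 * Y p $ 2)"
proof -
  have G: "Gamma_app p u v = Gamma_app p v u" for u v
    by (simp add: Gamma_app_def vec_eq_iff forall_3 algebra_simps)
  have "2 * d_eta S X Y p = df p (X p) / (2 * s p) * Y p $ 3 - df p (X p) / (2 * s p ^ 3) * Y p $ 1
    - (df p (Y p) / (2 * s p) * X p $ 3 - df p (Y p) / (2 * s p ^ 3) * X p $ 1)"
    unfolding d_eta_def nabla_eta_def dir_deriv_eta_app[OF p X] dir_deriv_eta_app[OF p Y]
    by (simp add: eta_app_def nabla_S inner_add_right G[of "Y p" "X p"])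
  also have "\<dots> = (pd 2 f p / (2 * s p ^ 3)) * (X p $ 1 * Y p $ 2 - X p $ 2 * Y p $ 1)
    + ((f p * pd 1 f p + pd 3 f p) / (2 * s p ^ 3)) * (X p $ 1 * Y p $ 3 - X p $ 3 * Y p $ 1)
    + (pd 2 f p / (2 * s p)) * (X p $ 2 * Y p $ 3 - X p $ 3 * Y p $ 2)"
    using s_pos[OF p] by (simp add: df_def f_eq[OF p] field_simps power2_eq_square power3_eq_cube)
  finally show ?thesis .
qed

section \<open>Closed \<eta> and the almost \<alpha>-paracosymplectic condition\<close>

abbreviation E :: "3 \<Rightarrow> real ^ 3 \<Rightarrow> real ^ 3" where "E i \<equiv> \<lambda>_. axis i 1"

lemma E_fields: "E i \<in> fields S"
  by (simp add: fields_def smooth_on_const)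

lemma fields_differentiable: "X \<in> fields S \<Longrightarrow> p \<in> M \<Longrightarrow> X differentiable (at p)"
  using smooth_on_differentiable by (auto simp: fields_def)

lemmas E_differentiable = fields_differentiable[OF E_fields]

lemma eta_closed_iff: "eta_closed S \<longleftrightarrow> (\<forall>p\<in>M. pd 2 f p = 0 \<and> pd 3 f p = - f p * pd 1 f p)"
proof
  assume e: "eta_closed S"
  show "\<forall>p\<in>M. pd 2 f p = 0 \<and> pd 3 f p = - f p * pd 1 f p"
  proof
    fix p assume p: "p \<in> M"
    have "d_eta S (E i) (E j) p = 0" for i j
      using e p E_fields by (auto simp: eta_closed_def)
    from this[of 1 2] this[of 1 3] d_eta_S[OF p E_differentiable[OF p, of 1] E_differentiable[OF p, of 2]]
      d_eta_S[OF p E_differentiable[OF p, of 1] E_differentiable[OF p, of 3]]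
    show "pd 2 f p = 0 \<and> pd 3 f p = - f p * pd 1 f p"
      using s_pos[OF p] by (simp add: axis_one_nth)
  qed
next
  assume a: "\<forall>p\<in>M. pd 2 f p = 0 \<and> pd 3 f p = - f p * pd 1 f p"
  show "eta_closed S"
    unfolding eta_closed_def base_S
  proof (intro ballI)
    fix X Y p assume "X \<in> fields S" "Y \<in> fields S" and p: "p \<in> M"
    then have "2 * d_eta S X Y p = 0"
      using a by (subst d_eta_S) (auto intro: fields_differentiable)
    then show "d_eta S X Y p = 0" by simp
  qed
qed

text \<open>\<open>d\<phi>\<close> and \<open>\<eta> \<and> \<phi>\<close> are 3-forms in dimension 3, hence multiples of \<open>dx \<and> dy \<and> dz\<close>.\<close>

definition vol :: "real ^ 3 \<Rightarrow> real ^ 3 \<Rightarrow> real ^ 3 \<Rightarrow> real" where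
  "vol u v w = det (vector [u, v, w] :: real ^ 3 ^ 3)"

lemma d_phi_S:
  assumes p: "p \<in> M" and "X differentiable (at p)" "Y differentiable (at p)" "Z differentiable (at p)"
  shows "d_phi S X Y Z p = - (pd 3 f p / (2 * s p ^ 3)) * vol (X p) (Y p) (Z p)"
  using s_pos[OF p]
  by (simp add: d_phi_def F_tensor_S[OF p] assms phi_deriv_def Gamma_app_def phi_S[OF p]
      inner_met_S df_def vol_def det_3 f_eq[OF p] field_simps power2_eq_square power3_eq_cube)

lemma eta_wedge_phi_S:
  assumes p: "p \<in> M"
  shows "eta_wedge_phi S X Y Z p = vol (X p) (Y p) (Z p)"
  using s_pos[OF p]
  by (simp add: eta_wedge_phi_def eta_app_def eta_S[OF p] phi_form_def metric_app_def phi_app_def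
      phi_S[OF p] inner_met_S vol_def det_3 f_eq[OF p] field_simps power2_eq_square)

lemma almost_alpha_paracosymplectic_iff:
  "almost_alpha_paracosymplectic \<alpha> S \<longleftrightarrow> smooth_on M \<alpha> \<and> eta_closed S \<and>
    (\<forall>p\<in>M. pd 3 f p = - 4 * \<alpha> p * s p ^ 3)"
proof -
  have eq: "(d_phi S X Y Z p = 2 * \<alpha> p * eta_wedge_phi S X Y Z p) \<longleftrightarrow>
      vol (X p) (Y p) (Z p) = 0 \<or> pd 3 f p = - 4 * \<alpha> p * s p ^ 3"
    if p: "p \<in> M" and "X \<in> fields S" "Y \<in> fields S" "Z \<in> fields S" for X Y Z p
  proof -
    have "(- (pd 3 f p / (2 * s p ^ 3)) = 2 * \<alpha> p) \<longleftrightarrow> pd 3 f p = - 4 * \<alpha> p * s p ^ 3"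
      using s_pos[OF p] by (auto simp: field_simps)
    then show ?thesis
      unfolding d_phi_S[OF p that(2-4)[THEN fields_differentiable[OF _ p]]] eta_wedge_phi_S[OF p] mult.assoc[symmetric]
        mult_cancel_right by (simp add: disj_commute)
  qed
  \<comment> \<open>On the coordinate frame the first alternative in \<open>eq\<close> is
    impossible, so each point yields the equation for f_z.\<close>
  have "vol (axis 1 1) (axis 2 1) (axis 3 1) \<noteq> 0"
    by (simp add: vol_def det_3 axis_one_nth)
  then have "(\<forall>X\<in>fields S. \<forall>Y\<in>fields S. \<forall>Z\<in>fields S. \<forall>p\<in>M.
        d_phi S X Y Z p = 2 * \<alpha> p * eta_wedge_phi S X Y Z p) \<longleftrightarrow>
      (\<forall>p\<in>M. pd 3 f p = - 4 * \<alpha> p * s p ^ 3)"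
    using E_fields eq by (smt (verit, best))
  then show ?thesis
    by (simp add: almost_alpha_paracosymplectic_def)
qed

lemma ex_almost_alpha_paracosymplectic_iff:
  "(\<exists>\<alpha>. almost_alpha_paracosymplectic \<alpha> S) \<longleftrightarrow> (\<forall>p\<in>M. pd 2 f p = 0 \<and> pd 3 f p = - f p * pd 1 f p)"
proof -
  \<comment> \<open>Solving f_z = - 4 \<alpha> s^3 for \<alpha>. Writing s^(-3) as the cube of
    \<open>\<xi>3\<close> makes \<alpha> smooth directly from the smoothness of
    \<open>\<xi>3\<close>.\<close>
  let ?a = "\<lambda>p. (- 1 / 4) * pd 3 f p * (\<xi>3 p * \<xi>3 p * \<xi>3 p)"
  have "smooth_on M ?a"
    by (intro smooth_on_mult open_M smooth_on_const smooth_on_pd smooth_f smooth_xi3)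
  moreover have "pd 3 f p = - 4 * ?a p * s p ^ 3" if "p \<in> M" for p
    using that xi3 s_pos[OF that] by (simp add: s_def[symmetric] power3_eq_cube)
  ultimately show ?thesis
    by (auto simp: almost_alpha_paracosymplectic_iff eta_closed_iff)
qed

text \<open>A finite shift along x replaces the comparison of mixed partials, so only first
  derivatives of \<open>s\<close> are used: s_z agrees at \<open>p\<close> and at the shifted point,
  which forces equal values of \<open>s\<close>, yet these differ by 2 a t.\<close>

lemma not_almost_alpha_para_Kenmotsu: "\<not> almost_alpha_para_Kenmotsu a S"
proof
  assume "almost_alpha_para_Kenmotsu a S"
  then have a: "a \<noteq> 0" and "\<And>p. p \<in> M \<Longrightarrow> pd 3 f p = - 4 * a * s p ^ 3"
    and "\<And>p. p \<in> M \<Longrightarrow> pd 3 f p = - f p * pd 1 f p"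
    by (auto simp: almost_alpha_para_Kenmotsu_def almost_alpha_paracosymplectic_iff eta_closed_iff)
  then have f3: "pd 3 f p = - 4 * a * s p ^ 3" and f1: "pd 1 f p = 4 * a * s p" if "p \<in> M" for p
    using s_pos[OF that] that f_eq[OF that] by (fastforce simp: power2_eq_square power3_eq_cube)+
  obtain p where p: "p \<in> M" using data by (auto simp: walker_data_def)
  obtain r where r: "r > 0" "ball p r \<subseteq> M" using open_M p by (auto simp: open_contains_ball)
  \<comment> \<open>Half the radius keeps every shift of a point of \<open>ball p (r / 2)\<close>
    inside \<open>M\<close>, so the shift identity holds near \<open>p\<close> and can be
    differentiated there.\<close>
  define t where "t = r / 2"
  let ?e = "axis 1 1 :: real ^ 3"
  text \<open>\<open>s\<close> grows with constant slope \<open>2 a\<close> along \<open>x\<close>, so \<open>s\<^sub>z = - 2 a s\<^sup>2\<close> cannot depend on \<open>x\<close>.\<close>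
  have shift: "s (q + t *\<^sub>R ?e) = s q + 2 * a * t" if q: "q \<in> ball p (r / 2)" for q
  proof -
    have inM: "q + u *\<^sub>R ?e \<in> M" if "0 \<le> u" "u \<le> t" for u
    proof -
      have "dist p (q + u *\<^sub>R ?e) \<le> dist p q + dist q (q + u *\<^sub>R ?e)" by (rule dist_triangle)
      also have "dist q (q + u *\<^sub>R ?e) \<le> r / 2" using that by (simp add: dist_norm t_def)
      also have "dist p q < r / 2" using q by simp
      finally show ?thesis using r by auto
    qed
    have "\<exists>c. \<forall>u\<in>{0..t}. s (q + u *\<^sub>R ?e) - 2 * a * u = c"
    proof (rule has_derivative_zero_constant)
      fix u assume u: "u \<in> {0..t}"
      have "((\<lambda>u. s (q + u *\<^sub>R ?e)) has_derivative
          (\<lambda>h. df (q + u *\<^sub>R ?e) (h *\<^sub>R ?e) / (2 * s (q + u *\<^sub>R ?e)))) (at u within {0..t})"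
        by (rule has_derivative_compose[where f = "\<lambda>u. q + u *\<^sub>R ?e" and f' = "\<lambda>h. h *\<^sub>R ?e"])
          (use u in \<open>auto intro!: derivative_eq_intros s_has_derivative inM\<close>)
      moreover have "df (q + u *\<^sub>R ?e) (h *\<^sub>R ?e) / (2 * s (q + u *\<^sub>R ?e)) = 2 * a * h" for h
        using f1[OF inM[of u]] s_pos[OF inM[of u]] u by (simp add: df_def axis_one_nth)
      ultimately have "((\<lambda>u. s (q + u *\<^sub>R ?e)) has_derivative (\<lambda>h. 2 * a * h)) (at u within {0..t})"
        by simp
      then show "((\<lambda>u. s (q + u *\<^sub>R ?e) - 2 * a * u) has_derivative (\<lambda>h. 0)) (at u within {0..t})"
        by (auto intro!: derivative_eq_intros)
    qed simp
    then have "s (q + t *\<^sub>R ?e) - 2 * a * t = s (q + 0 *\<^sub>R ?e) - 2 * a * 0"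
      using r by (metis atLeastAtMost_iff order_refl t_def half_gt_zero less_imp_le)
    then show ?thesis by simp
  qed
  let ?q = "p + t *\<^sub>R ?e"
  have q: "?q \<in> M" using r by (auto simp: t_def dist_norm intro!: subsetD[OF r(2)])
  \<comment> \<open>The same function gets two derivatives at \<open>p\<close>: ds at
    \<open>?q\<close> by the chain rule, and ds at \<open>p\<close> by \<open>shift\<close>.\<close>
  have "((\<lambda>q. s (q + t *\<^sub>R ?e)) has_derivative (\<lambda>h. df ?q h / (2 * s ?q))) (at p)"
    by (rule has_derivative_compose[where f = "\<lambda>q. q + t *\<^sub>R ?e" and f' = "\<lambda>h. h"])
      (auto intro!: derivative_eq_intros s_has_derivative q)
  moreover have "((\<lambda>q. s q + 2 * a * t) has_derivative (\<lambda>h. df p h / (2 * s p))) (at p)"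
    by (auto intro!: derivative_eq_intros s_has_derivative p)
  then have "((\<lambda>q. s (q + t *\<^sub>R ?e)) has_derivative (\<lambda>h. df p h / (2 * s p))) (at p)"
    by (rule has_derivative_transform_within_open[OF _ open_ball[of p "r / 2"]]) (use r shift in auto)
  ultimately have "df ?q (axis 3 1) / (2 * s ?q) = df p (axis 3 1) / (2 * s p)"
    by (metis has_derivative_unique)
  \<comment> \<open>Both sides are s_z = - 2 a s^2, and a is nonzero.\<close>
  then have "(s ?q)\<^sup>2 = (s p)\<^sup>2"
    using a f3[OF p] f3[OF q] s_pos[OF p] s_pos[OF q]
    by (simp add: df_def axis_one_nth power2_eq_square power3_eq_cube)
  then have "s ?q = s p" using s_pos[OF p] s_pos[OF q] by (simp add: power2_eq_iff_nonneg)
  then show False using shift[of p] a r by (simp add: t_def)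
qed

section \<open>Normality and membership in G12\<close>

lemma normal_imp:
  assumes n: "normal_apcm S" and p: "p \<in> M"
  shows "pd 1 f p = 0" "pd 2 f p = 0" "pd 3 f p = 0"
proof -
  have 0: "dir_deriv X (E i) q = 0" for X q i
    by (simp add: dir_deriv_def frechet_derivative_const)
  note D = dir_deriv_phi_app[OF p E_differentiable[OF p]] E_differentiable[OF p]
  have N: "nijenhuis S (E i) (E j) p - (2 * d_eta S (E i) (E j) p) *\<^sub>R xi S p = 0" for i j
    using n p E_fields by (auto simp: normal_apcm_def)
  have 12: "nijenhuis S (E 1) (E 2) p = vector [0, - (pd 3 f p / (2 * s p ^ 4)), pd 2 f p / s p ^ 4]"
    using s_pos[OF p]
    by (simp add: nijenhuis_def lie_bracket_def 0 D phi_app_def phi_S[OF p] phi_deriv_def df_def axis_one_nth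
        vec_eq_iff forall_3 f_eq[OF p] field_simps power2_eq_square power3_eq_cube power4_eq_xxxx)
  have 13: "nijenhuis S (E 1) (E 3) p $ 3 = pd 3 f p / (2 * s p ^ 4)"
    using s_pos[OF p]
    by (simp add: nijenhuis_def lie_bracket_def 0 D phi_app_def phi_S[OF p] phi_deriv_def df_def axis_one_nth
        field_simps power2_eq_square power3_eq_cube power4_eq_xxxx)
  \<comment> \<open>\<xi> has only a third component. For (\<open>E 1\<close>, \<open>E 2\<close>)
    the second component gives f_z = 0 and the third f_y / (2 s^4) = 0. For (\<open>E 1\<close>,
    \<open>E 3\<close>) the f_z terms cancel in the third component, leaving - f_x / (2 s^2) =
    0.\<close>
  show "pd 1 f p = 0" "pd 2 f p = 0" "pd 3 f p = 0"
    using N[of 1 2] N[of 1 3] 12 13 s_pos[OF p]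
      d_eta_S[OF p E_differentiable[OF p, of 1] E_differentiable[OF p, of 2]]
      d_eta_S[OF p E_differentiable[OF p, of 1] E_differentiable[OF p, of 3]]
    by (simp_all add: vec_eq_iff forall_3 xi_S[OF p] axis_one_nth f_eq[OF p] field_simps
        power2_eq_square power3_eq_cube power4_eq_xxxx)
qed

lemma in_G12_iff: "in_G12 S \<longleftrightarrow> (\<forall>p\<in>M. pd 2 f p = 0 \<and> pd 3 f p = 0)"
proof
  assume g: "in_G12 S"
  show "\<forall>p\<in>M. pd 2 f p = 0 \<and> pd 3 f p = 0"
  proof
    fix p assume p: "p \<in> M"
    \<comment> \<open>\<open>K\<close> is the factor common to all three first arguments. Since
      \<eta> takes the values 1/s, 0, s on the frame, \<open>E 2\<close> gives f_y = 0, and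
      eliminating \<open>K\<close> between \<open>E 1\<close> and \<open>E 3\<close> gives f_z =
      0.\<close>
    define K where "K = eta_app S (E 1) p * F_tensor S (xi S) (xi S) (E 2) p
        - eta_app S (E 2) p * F_tensor S (xi S) (xi S) (E 1) p"
    have "F_tensor S (E i) (E 1) (E 2) p = eta_app S (E i) p * K" for i
      using g p E_fields unfolding in_G12_def K_def by auto
    from this[of 1] this[of 2] this[of 3]
    have "pd 1 f p = - 2 * K * s p * s p" "pd 2 f p = 0"
      "pd 3 f p = - (s p * s p * pd 1 f p) - 2 * K * s p * s p * s p * s p"
      using s_pos[OF p]
      by (simp_all add: F_tensor_S[OF p] E_differentiable[OF p] eta_app_def eta_S[OF p]
        phi_deriv_def Gamma_app_def phi_S[OF p] inner_met_S df_def axis_one_nth f_eq[OF p]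
        field_simps power2_eq_square power3_eq_cube)
    then show "pd 2 f p = 0 \<and> pd 3 f p = 0" by simp
  qed
next
  assume a: "\<forall>p\<in>M. pd 2 f p = 0 \<and> pd 3 f p = 0"
  show "in_G12 S"
    unfolding in_G12_def base_S
  proof (intro ballI)
    fix X Y Z p assume XYZ: "X \<in> fields S" "Y \<in> fields S" "Z \<in> fields S" and p: "p \<in> M"
    note d = fields_differentiable[OF XYZ(2) p] xi_S_differentiable[OF p]
    show "F_tensor S X Y Z p = eta_app S X p * (eta_app S Y p * F_tensor S (xi S) (xi S) Z p
                        - eta_app S Z p * F_tensor S (xi S) (xi S) Y p)"
      using s_pos[OF p] a p
      by (simp add: F_tensor_S[OF p] d eta_app_def eta_S[OF p] xi_S[OF p]
        phi_deriv_def Gamma_app_def phi_S[OF p] inner_met_S df_def f_eq[OF p]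
        field_simps power2_eq_square power3_eq_cube)
  qed
qed

section \<open>Nonconstant f and the combined classification\<close>

lemma not_locally_constantD:
  assumes "not_locally_constant M f"
  shows "\<exists>p\<in>M. pd 1 f p \<noteq> 0 \<or> pd 2 f p \<noteq> 0 \<or> pd 3 f p \<noteq> 0"
proof (rule ccontr)
  assume "\<not> ?thesis"
  then have "df p = (\<lambda>v. 0)" if "p \<in> M" for p using that by (auto simp: df_def)
  then show False
    using assms f_has_derivative by (metis frechet_derivative_at not_locally_constant_def)
qed

end

theorem theorem4p3:
  fixes M :: "(real ^ 3) set" and f \<xi>1 \<xi>2 \<xi>3 :: "real ^ 3 \<Rightarrow> real" and S :: "3 apcm"
  assumes data: "walker_data M f \<xi>1 \<xi>2 \<xi>3"
    and S: "S = walker_apcm M f \<xi>1 \<xi>2 \<xi>3"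
    and f_pos: "\<forall>p\<in>M. f p > 0"
    and xi12: "\<forall>p\<in>M. \<xi>1 p = 0 \<and> \<xi>2 p = 0"
    and xi3: "\<forall>p\<in>M. \<xi>3 p = 1 / sqrt (f p)"
  shows
    "((not_locally_constant M f \<longrightarrow>
          \<not> paracosymplectic S
        \<and> \<not> quasi_para_Sasakian S
        \<and> \<not> (\<exists>\<alpha>. alpha_paracosymplectic \<alpha> S)
        \<and> \<not> almost_paracosymplectic S
        \<and> \<not> normal_apcm S)
      \<and> \<not> (\<exists>a. alpha_para_Kenmotsu a S))
   \<and> ((not_locally_constant M f \<longrightarrow>
        ((\<exists>\<alpha>. almost_alpha_paracosymplectic \<alpha> S) \<longleftrightarrow>
          (\<forall>p\<in>M. pd 2 f p = 0) \<and> (\<forall>p\<in>M. pd 3 f p = - f p * pd 1 f p) \<and> (\<exists>p\<in>M. pd 3 f p \<noteq> 0)))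
      \<and> \<not> (\<exists>a. almost_alpha_para_Kenmotsu a S))
   \<and> (not_locally_constant M f \<longrightarrow>
        (in_G12 S \<longleftrightarrow>
          (\<forall>p\<in>M. pd 2 f p = 0 \<and> pd 3 f p = 0) \<and> (\<exists>p\<in>M. pd 1 f p \<noteq> 0)))"
proof -
  interpret vertical_walker M f \<xi>1 \<xi>2 \<xi>3 S
    using assms by unfold_locales
  have nn: "\<not> normal_apcm S" if "not_locally_constant M f"
    using not_locally_constantD[OF that] normal_imp by blast
  \<comment> \<open>Here \<alpha> = 0 gives f_z = 0, and then f_z = - f f_x with f > 0 gives f_x =
    0, so df = 0 everywhere.\<close>
  have nap: "\<not> almost_paracosymplectic S" if "not_locally_constant M f"
    using not_locally_constantD[OF that] f_pos
    by (fastforce simp: almost_paracosymplectic_def almost_alpha_paracosymplectic_iff eta_closed_iff)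
  \<comment> \<open>At a point where df does not vanish, the equations leave f_x nonzero, and f > 0
    carries this over to f_z.\<close>
  have "(\<exists>p\<in>M. pd 3 f p \<noteq> 0)"
    if "not_locally_constant M f" "\<forall>p\<in>M. pd 2 f p = 0 \<and> pd 3 f p = - f p * pd 1 f p"
    using not_locally_constantD[OF that(1)] that(2) f_pos by (metis mult_eq_0_iff neg_equal_0_iff_equal less_irrefl)
  moreover have "(\<exists>p\<in>M. pd 1 f p \<noteq> 0)"
    if "not_locally_constant M f" "\<forall>p\<in>M. pd 2 f p = 0 \<and> pd 3 f p = 0"
    using not_locally_constantD[OF that(1)] that(2) by blast
  ultimately show ?thesis
    using nn nap not_almost_alpha_para_Kenmotsu
    unfolding paracosymplectic_def quasi_para_Sasakian_def alpha_paracosymplectic_def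
      alpha_para_Kenmotsu_def ex_almost_alpha_paracosymplectic_iff in_G12_iff
    by blast
qed

end
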